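(* Let $l\geq2$ and let $H$ be an $l$-modest hypergraph. Then (i) for every $k$ with $2k\leq 2l$, every minimal dense vertex set of cardinality $2k$ is the set of vertices of a witnessed cycle of length $k$; and (ii) for every $k\le l$, the set of vertices of every witnessed cycle of length $k$ is a minimal dense set of cardinality $2k$.
   Context: A hypergraph is a pair $H=(U,T)$ with $U$ a finite nonempty vertex set and $T$ a collection of 3-element subsets of $U$ (hyperedges). For nonempty $X\subseteq U$, $\|X\|$ is its cardinality and $[X]$ (weight) is the number of hyperedges contained in $X$. $X$ is dense if $\|X\|\leq 2[X]$ and super-dense if $\|X\|<2[X]$; a minimal dense set is a dense set no proper nonempty subset of which is dense. $H$ is $l$-modest if it has no super-dense vertex sets of cardinality $\leq 2l$. Vertices $x,y$ are adjacent if there is a hyperedge $\{x,y,z\}$; $z$ witnesses the adjacency. A sequence $x_1,\dots,x_k$ of $k\geq3$ distinct vertices (indices mod $k$) is a weak cycle if each $x_i$ is adjacent to $x_{i+1}$ and either $k>3$ or $\{x_1,x_2,x_3\}$ is not a hyperedge; it is a cycle of length $k$ if moreover no $\{x_i,x_{i+1},x_{i+2}\}$ is a hyperedge; a corresponding witnessed cycle of length $k$ is a vertex sequence $x_1,\dots,x_k,y_1,\dots,y_k$ where each $y_i$ witnesses that $x_i$ is adjacent to $x_{i+1}$. A sequence $x_1,x_2$ is a cycle of length 2 if there are distinct vertices $y_1,y_2$ different from $x_1,x_2$ with $\{x_1,x_2,y_1\}$ and $\{x_1,x_2,y_2\}$ hyperedges; then $x_1,x_2,y_1,y_2$ is a corresponding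 witnessed cycle of length 2. *)

theory Defs
  imports Main
begin

definition hypergraph :: "'a set \<Rightarrow> 'a set set \<Rightarrow> bool" where
  "hypergraph U T \<longleftrightarrow> finite U \<and> U \<noteq> {} \<and> (\<forall>e\<in>T. e \<subseteq> U \<and> card e = 3)"

definition weight :: "'a set set \<Rightarrow> 'a set \<Rightarrow> nat" where
  "weight T X = card {e \<in> T. e \<subseteq> X}"

definition dense_set :: "'a set \<Rightarrow> 'a set set \<Rightarrow> 'a set \<Rightarrow> bool" where
  "dense_set U T X \<longleftrightarrow> X \<subseteq> U \<and> X \<noteq> {} \<and> card X \<le> 2 * weight T X"

definition super_dense_set :: "'a set \<Rightarrow> 'a set set \<Rightarrow> 'a set \<Rightarrow> bool" where
  "super_dense_set U T X \<longleftrightarrow> X \<subseteq> U \<and> X \<noteq> {} \<and> card X < 2 * weight T X"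

definition minimal_dense_set :: "'a set \<Rightarrow> 'a set set \<Rightarrow> 'a set \<Rightarrow> bool" where
  "minimal_dense_set U T X \<longleftrightarrow>
     dense_set U T X \<and> (\<forall>Y. Y \<noteq> {} \<and> Y \<subset> X \<longrightarrow> \<not> dense_set U T Y)"

definition modest :: "nat \<Rightarrow> 'a set \<Rightarrow> 'a set set \<Rightarrow> bool" where
  "modest l U T \<longleftrightarrow> (\<forall>X \<subseteq> U. card X \<le> 2 * l \<longrightarrow> \<not> super_dense_set U T X)"

(* In a hypergraph, {x, y, z} \<in> T forces x, y, z to be pairwise distinct, since
   hyperedges have exactly three elements. *)
definition witnesses :: "'a set set \<Rightarrow> 'a \<Rightarrow> 'a \<Rightarrow> 'a \<Rightarrow> bool" where
  "witnesses T z x y \<longleftrightarrow> {x, y, z} \<in> T"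

definition adjacent :: "'a set set \<Rightarrow> 'a \<Rightarrow> 'a \<Rightarrow> bool" where
  "adjacent T x y \<longleftrightarrow> (\<exists>z. witnesses T z x y)"

(* Sequences are lists, indexed from 0 and cyclically modulo their length. *)
definition weak_cycle :: "'a set \<Rightarrow> 'a set set \<Rightarrow> 'a list \<Rightarrow> bool" where
  "weak_cycle U T xs \<longleftrightarrow>
     3 \<le> length xs \<and> distinct xs \<and> set xs \<subseteq> U \<and>
     (\<forall>i < length xs. adjacent T (xs ! i) (xs ! ((i + 1) mod length xs))) \<and>
     (length xs > 3 \<or> {xs ! 0, xs ! 1, xs ! 2} \<notin> T)"

definition long_cycle :: "'a set \<Rightarrow> 'a set set \<Rightarrow> 'a list \<Rightarrow> bool" where
  "long_cycle U T xs \<longleftrightarrow>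
     weak_cycle U T xs \<and>
     (\<forall>i < length xs.
        {xs ! i, xs ! ((i + 1) mod length xs), xs ! ((i + 2) mod length xs)} \<notin> T)"

definition witnessed_long_cycle :: "'a set \<Rightarrow> 'a set set \<Rightarrow> 'a list \<Rightarrow> 'a list \<Rightarrow> bool" where
  "witnessed_long_cycle U T xs ys \<longleftrightarrow>
     long_cycle U T xs \<and> length ys = length xs \<and> set ys \<subseteq> U \<and>
     (\<forall>i < length xs. witnesses T (ys ! i) (xs ! i) (xs ! ((i + 1) mod length xs)))"

definition witnessed_two_cycle :: "'a set \<Rightarrow> 'a set set \<Rightarrow> 'a list \<Rightarrow> 'a list \<Rightarrow> bool" where
  "witnessed_two_cycle U T xs ys \<longleftrightarrow>
     (\<exists>x1 x2 y1 y2. xs = [x1, x2] \<and> ys = [y1, y2] \<and> {x1, x2, y1, y2} \<subseteq> U \<and>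
        y1 \<noteq> y2 \<and> y1 \<notin> {x1, x2} \<and> y2 \<notin> {x1, x2} \<and>
        {x1, x2, y1} \<in> T \<and> {x1, x2, y2} \<in> T)"

(* The x-part xs and the y-part ys of the sequence are kept apart.  The length of
   the witnessed cycle is the length of xs, and is at least 2.  In the long case
   nothing is required a priori about equalities among the ys, or between entries
   of xs and ys. *)
definition witnessed_cycle :: "'a set \<Rightarrow> 'a set set \<Rightarrow> nat \<Rightarrow> 'a list \<Rightarrow> 'a list \<Rightarrow> bool" where
  "witnessed_cycle U T k xs ys \<longleftrightarrow>
     length xs = k \<and> (witnessed_two_cycle U T xs ys \<or> witnessed_long_cycle U T xs ys)"

end

theory Submission
  imports Defs
begin

text \<open>
  The \<open>k\<close> hyperedges of a witnessed cycle are distinct and span at most \<open>2k\<close> vertices, so modesty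
  forces exactly \<open>2k\<close> vertices and no further hyperedge; a proper nonempty subset containing \<open>m > 0\<close>
  of the hyperedges has at least \<open>m\<close> witnesses and \<open>m + 1\<close> cycle vertices, hence is not dense.

  Conversely, in a minimal dense set with \<open>2k\<close> vertices every vertex has positive degree and no
  hyperedge contains two vertices of degree one.  As the degrees sum to \<open>3k\<close>, every hyperedge has
  exactly one vertex of degree one.  The remaining \<open>k\<close> vertices form a (multi)graph of minimum
  degree two, which contains a cycle; that cycle is dense, so by minimality it exhausts the set.
\<close>

section \<open>Cyclic index sets and cycles in graphs of minimum degree two\<close>

text \<open>Iterating the cyclic successor from a single element of \<open>I\<close> reaches every
  index below \<open>k\<close>. Its use is contrapositive: a proper nonempty set of edge indices has
  an element whose successor lies outside the set.\<close>

lemma cyclic_closed_eq: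
  assumes "I \<subseteq> {..<k}" and "I \<noteq> {}" and closed: "\<And>i. i \<in> I \<Longrightarrow> Suc i mod k \<in> I"
  shows "I = {..<k}"
proof -
  obtain i where i: "i \<in> I" using assms(2) by blast
  then have "0 < k" using assms(1) by force
  have shift: "(i + n) mod k \<in> I" for n
  proof (induction n)
    case 0
    then show ?case using i assms(1) by (metis add.right_neutral lessThan_iff mod_less subsetD)
  next
    case (Suc n)
    then show ?case using closed[OF Suc] by (simp add: mod_Suc_eq)
  qed
  have "j \<in> I" if "j < k" for j
  proof -
    have "i < k" using i assms(1) by blast
    \<comment> \<open>The extra \<open>k\<close> keeps the subtraction on naturals from truncating
      when \<open>j < i\<close>.\<close>
    then have "(i + (j + k - i)) mod k = j" using that by simp
    then show ?thesis using shift by metis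
  qed
  then show ?thesis using assms(1) by blast
qed

lemma finite_path_bound:
  assumes "finite D" and "distinct xs" and "set xs \<subseteq> D"
  shows "length xs \<le> card D"
  using assms by (metis card_mono distinct_card)

text \<open>The first vertex of a longest path has all its neighbours on the path.\<close>

lemma min_degree_two_cycle:
  assumes fin: "finite D" and ne: "D \<noteq> {}"
    and sym: "\<And>x y. R x y \<Longrightarrow> R y x" and irrefl: "\<And>x. \<not> R x x"
    and deg: "\<And>x. x \<in> D \<Longrightarrow> \<exists>a\<in>D. \<exists>b\<in>D. a \<noteq> b \<and> R x a \<and> R x b"
  obtains xs where "3 \<le> length xs" "distinct xs" "set xs \<subseteq> D"
    "\<And>i. i < length xs \<Longrightarrow> R (xs ! i) (xs ! (Suc i mod length xs))"
proof -
  define P where "P xs \<longleftrightarrow> xs \<noteq> [] \<and> distinct xs \<and> set xs \<subseteq> D \<and> successively R xs" for xs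
  obtain d where "d \<in> D" using ne by blast
  then have "P [d]" by (simp add: P_def)
  moreover have "\<forall>xs. P xs \<longrightarrow> length xs < Suc (card D)"
    using finite_path_bound[OF fin] by (auto simp: P_def less_Suc_eq_le)
  ultimately obtain xs where xs: "P xs" and max: "\<And>zs. P zs \<Longrightarrow> length zs \<le> length xs"
    using ex_has_greatest_nat[of P "[d]" length "Suc (card D)"] by blast
  have hd: "xs ! 0 \<in> D" using xs by (auto simp: P_def)
  \<comment> \<open>Of two distinct neighbours of the first vertex, at least one differs from the
    second vertex of the path. The guard covers a path consisting of one vertex.\<close>
  obtain z where z: "z \<in> D" "R (xs ! 0) z" "1 < length xs \<Longrightarrow> z \<noteq> xs ! 1"
    using deg[OF hd] by metis
  have "z \<in> set xs"
  proof (rule ccontr)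
    assume "z \<notin> set xs"
    then have "P (z # xs)"
      using xs z sym by (auto simp: P_def successively_Cons hd_conv_nth)
    then show False using max by fastforce
  qed
  then obtain j where j: "j < length xs" "z = xs ! j" by (metis in_set_conv_nth)
  have "j \<noteq> 0" using j z irrefl by metis
  moreover have "j \<noteq> 1" using j z by metis
  ultimately have j2: "2 \<le> j" by linarith
  \<comment> \<open>The edge between \<open>z\<close> and the first vertex closes this initial
    segment; since \<open>z\<close> is neither of the first two vertices, the segment has length at
    least 3.\<close>
  define c where "c = take (Suc j) xs"
  have len: "length c = Suc j" using j by (simp add: c_def)
  show thesis
  proof (rule that[of c])
    show "3 \<le> length c" using len j2 by simp
    show "distinct c" using xs by (simp add: c_def P_def)
    show "set c \<subseteq> D" using xs set_take_subset by (fastforce simp: c_def P_def)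
    fix i assume i: "i < length c"
    show "R (c ! i) (c ! (Suc i mod length c))"
    proof (cases "i = j")
      case True
      then show ?thesis using z j sym len by (simp add: c_def)
    next
      case False
      then have "Suc i < length xs" "i < j" using i len j by auto
      then show ?thesis using xs len
        by (auto simp: c_def P_def successively_conv_nth)
    qed
  qed
qed

section \<open>Vertex sets of witnessed cycles are minimal dense\<close>

lemma hypergraph_finite_edges:
  assumes "hypergraph U T"
  shows "finite T"
proof (rule finite_subset)
  show "T \<subseteq> Pow U" using assms by (auto simp: hypergraph_def)
  show "finite (Pow U)" using assms by (simp add: hypergraph_def)
qed

lemma modest_weight_le:
  assumes "modest l U T" and "X \<subseteq> U" and "X \<noteq> {}" and "card X \<le> 2 * l"
  shows "2 * weight T X \<le> card X"
  using assms by (auto simp: modest_def super_dense_set_def not_less)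

text \<open>Common core for cycles of length 2 and longer ones, which differ only in why the
  \<open>k\<close> edges are distinct. That the witnesses are distinct and lie off the cycle is
  derived from modesty.\<close>

lemma cyclic_edges_minimal_dense:
  assumes H: "hypergraph U T" and modest: "modest l U T"
    and "0 < k" and "k \<le> l"
    and lx: "length xs = k" and ly: "length ys = k"
    and dx: "distinct xs" and xU: "set xs \<subseteq> U" and yU: "set ys \<subseteq> U"
    and E: "\<And>i. E i = {xs ! i, xs ! (Suc i mod k), ys ! i}"
    and ET: "\<And>i. i < k \<Longrightarrow> E i \<in> T" and inj: "inj_on E {..<k}"
  shows "minimal_dense_set U T (set xs \<union> set ys) \<and> card (set xs \<union> set ys) = 2 * k"
proof -
  let ?V = "set xs \<union> set ys"
  have VU: "?V \<subseteq> U" and Vne: "?V \<noteq> {}" using xU yU lx \<open>0 < k\<close> by auto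
  have finT: "finite T" using hypergraph_finite_edges[OF H] .
  have EV: "E ` {..<k} \<subseteq> {e \<in> T. e \<subseteq> ?V}"
    using ET lx ly \<open>0 < k\<close> by (auto simp: E)
  have cE: "card (E ` {..<k}) = k" using inj by (simp add: card_image)
  have w: "k \<le> weight T ?V" unfolding weight_def
    using card_mono[OF _ EV] finT cE by simp
  have cx: "card (set xs) = k" using dx lx by (simp add: distinct_card)
  have cy: "card (set ys) \<le> k" using ly card_length by blast
  have split: "card ?V + card (set xs \<inter> set ys) = k + card (set ys)"
    using card_Un_Int[of "set xs" "set ys"] cx by simp
  \<comment> \<open>Modesty applies because the union has at most \<open>2 * k\<close> vertices.
    With \<open>w\<close> this gives a chain from \<open>2 * k\<close> back to \<open>2 * k\<close>,
    so every inequality in it is an equality.\<close>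
  have "2 * weight T ?V \<le> card ?V"
    using modest_weight_le[OF modest VU Vne] split cy \<open>k \<le> l\<close> by linarith
  then have cV: "card ?V = 2 * k" and wV: "weight T ?V = k"
    and cyk: "card (set ys) = k" and "card (set xs \<inter> set ys) = 0"
    using w split cy by linarith+
  then have disj: "set xs \<inter> set ys = {}" by simp
  have dy: "distinct ys" using cyk ly by (simp add: card_distinct)
  \<comment> \<open>The \<open>k\<close> cyclic edges already account for the whole weight, so the
    weight of a subset can be computed by counting indices.\<close>
  have edges: "{e \<in> T. e \<subseteq> ?V} = E ` {..<k}"
    using card_subset_eq[OF _ EV] finT cE wV by (simp add: weight_def)
  have "\<not> dense_set U T Y" if Y: "Y \<noteq> {}" "Y \<subset> ?V" for Y
  proof -
    define I where "I = {i. i < k \<and> E i \<subseteq> Y}"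
    define s where "s i = Suc i mod k" for i
    have I: "I \<subseteq> {..<k}" by (auto simp: I_def)
    have sk: "s i < k" for i using \<open>0 < k\<close> by (simp add: s_def)
    have finI: "finite I" using I finite_subset by blast
    have finY: "finite Y" using Y(2) finite_subset[of Y ?V] by auto
    have "{e \<in> T. e \<subseteq> Y} = E ` I"
    proof -
      have "{e \<in> T. e \<subseteq> Y} = {e \<in> {e \<in> T. e \<subseteq> ?V}. e \<subseteq> Y}" using Y by blast
      then show ?thesis unfolding edges by (auto simp: I_def)
    qed
    then have wY: "weight T Y = card I"
      using inj_on_subset[OF inj I] by (simp add: weight_def card_image)
    have "I \<noteq> {..<k}"
    proof
      assume "I = {..<k}"
      then have "\<And>i. i < k \<Longrightarrow> xs ! i \<in> Y \<and> ys ! i \<in> Y" by (auto simp: I_def E)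
      then have "?V \<subseteq> Y" using lx ly by (auto simp: in_set_conv_nth)
      then show False using Y by blast
    qed
    have "2 * card I < card Y"
    proof (cases "I = {}")
      case True
      then show ?thesis using Y finY by (simp add: card_gt_0_iff)
    next
      case False
      \<comment> \<open>Some successor leaves \<open>I\<close>, so the edges inside \<open>Y\<close>
        touch at least \<open>card I + 1\<close> cycle vertices; together with their
        \<open>card I\<close> witnesses this exceeds \<open>2 * card I\<close>.\<close>
      have "\<not> s ` I \<subseteq> I"
        using cyclic_closed_eq[OF I False] \<open>I \<noteq> {..<k}\<close> by (auto simp: s_def)
      then have "card I < card (I \<union> s ` I)" using finI by (intro psubset_card_mono) auto
      moreover have "card ((!) xs ` (I \<union> s ` I)) = card (I \<union> s ` I)"
        using dx lx I sk by (intro card_image inj_on_nth) auto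
      moreover have "card ((!) ys ` I) = card I"
        using dy ly I by (intro card_image inj_on_nth) auto
      moreover have "(!) xs ` (I \<union> s ` I) \<subseteq> set xs" "(!) ys ` I \<subseteq> set ys"
        using lx ly I sk by auto
      then have "card ((!) xs ` (I \<union> s ` I) \<union> (!) ys ` I)
          = card ((!) xs ` (I \<union> s ` I)) + card ((!) ys ` I)"
        using disj finI by (intro card_Un_disjoint) auto
      moreover have "(!) xs ` (I \<union> s ` I) \<union> (!) ys ` I \<subseteq> Y"
        by (auto simp: I_def E s_def)
      then have "card ((!) xs ` (I \<union> s ` I) \<union> (!) ys ` I) \<le> card Y"
        using finY card_mono by blast
      ultimately show ?thesis by linarith
    qed
    then show ?thesis using wY by (simp add: dense_set_def)
  qed
  then show ?thesis
    using VU Vne cV wV by (simp add: minimal_dense_set_def dense_set_def)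
qed

text \<open>Equal consecutive edges would make three consecutive cycle vertices a hyperedge, which a
  cycle excludes. Equal edges at distinct non-consecutive indices would contain four distinct cycle
  vertices, too many for a hyperedge.\<close>

lemma long_cycle_edges_inj:
  assumes H: "hypergraph U T" and C: "witnessed_long_cycle U T xs ys"
  shows "inj_on (\<lambda>i. {xs ! i, xs ! (Suc i mod length xs), ys ! i}) {..<length xs}"
proof -
  define k where "k = length xs"
  define s where "s i = Suc i mod k" for i
  define E where "E i = {xs ! i, xs ! s i, ys ! i}" for i
  have k3: "3 \<le> k" and dx: "distinct xs"
    using C by (auto simp: witnessed_long_cycle_def long_cycle_def weak_cycle_def k_def)
  have sk: "s i < k" for i using k3 by (simp add: s_def)
  have ET: "E i \<in> T" if "i < k" for i
    using C that
    by (auto simp: witnessed_long_cycle_def witnesses_def E_def s_def k_def insert_commute)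
  then have E3: "card (E i) = 3" if "i < k" for i
    using H that by (auto simp: hypergraph_def)
  then have finE: "finite (E i)" if "i < k" for i
    using that by (metis card.infinite zero_neq_numeral)
  have no3: "{xs ! i, xs ! s i, xs ! s (s i)} \<notin> T" if "i < k" for i
    using C that by (auto simp: witnessed_long_cycle_def long_cycle_def k_def s_def mod_Suc_eq)
  have eq: "xs ! i = xs ! j \<longleftrightarrow> i = j" if "i < k" "j < k" for i j
    using dx that by (simp add: nth_eq_iff_index_eq k_def)
  have s_ne: "s i \<noteq> i" if "i < k" for i
    using that k3 by (auto simp: s_def mod_Suc)
  \<comment> \<open>Length at least 3 matters here: on two indices the second successor is the
    starting index.\<close>
  have ss_ne: "s (s i) \<noteq> i" if "i < k" for i
    using that k3 by (auto simp: s_def mod_Suc)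
  have s_inj: "i = j" if "i < k" "j < k" "s i = s j" for i j
    using that by (auto simp: s_def mod_Suc split: if_splits)
  have succ: "E i \<noteq> E (s i)" if "i < k" for i
  proof
    assume "E i = E (s i)"
    then have sub: "{xs ! i, xs ! s i, xs ! s (s i)} \<subseteq> E i" by (auto simp: E_def)
    have "xs ! s i \<noteq> xs ! i" "xs ! s (s i) \<noteq> xs ! s i" "xs ! s (s i) \<noteq> xs ! i"
      using eq[OF sk that] eq[OF sk sk] s_ne[OF that] s_ne[OF sk] ss_ne[OF that] by blast+
    then have "card {xs ! i, xs ! s i, xs ! s (s i)} = 3"
      by (auto simp: card_insert_if)
    then have "{xs ! i, xs ! s i, xs ! s (s i)} = E i"
      using sub E3 finE that by (intro card_subset_eq) auto
    then show False using no3 ET that by metis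
  qed
  have "inj_on E {..<k}"
  proof (rule inj_onI, rule ccontr)
    fix i j assume ij: "i \<in> {..<k}" "j \<in> {..<k}" "E i = E j" "i \<noteq> j"
    then have "j \<noteq> s i" "i \<noteq> s j" using succ by auto
    moreover have "s i \<noteq> s j" using s_inj ij by blast
    ultimately have "xs ! i \<noteq> xs ! s i" "xs ! i \<noteq> xs ! j" "xs ! i \<noteq> xs ! s j"
        "xs ! s i \<noteq> xs ! j" "xs ! s i \<noteq> xs ! s j" "xs ! j \<noteq> xs ! s j"
      using ij(1,2,4) by (simp_all add: eq sk s_ne s_ne[symmetric])
    then have "card {xs ! i, xs ! s i, xs ! j, xs ! s j} = 4"
      by (simp add: card_insert_if)
    moreover have "{xs ! i, xs ! s i, xs ! j, xs ! s j} \<subseteq> E i"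
      using ij(3) by (auto simp: E_def)
    then have "card {xs ! i, xs ! s i, xs ! j, xs ! s j} \<le> 3"
      using card_mono[OF finE] E3 ij by fastforce
    ultimately show False by simp
  qed
  then show ?thesis unfolding E_def s_def k_def .
qed

lemma witnessed_cycle_minimal_dense:
  assumes H: "hypergraph U T" and modest: "modest l U T" and "k \<le> l"
    and C: "witnessed_cycle U T k xs ys"
  shows "minimal_dense_set U T (set xs \<union> set ys) \<and> card (set xs \<union> set ys) = 2 * k"
proof -
  let ?E = "\<lambda>i. {xs ! i, xs ! (Suc i mod k), ys ! i}"
  have k: "length xs = k" using C by (simp add: witnessed_cycle_def)
  consider "witnessed_two_cycle U T xs ys" | "witnessed_long_cycle U T xs ys"
    using C by (auto simp: witnessed_cycle_def)
  then show ?thesis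
  proof cases
    case 1
    then obtain x1 x2 y1 y2 where xy: "xs = [x1, x2]" "ys = [y1, y2]" "{x1, x2, y1, y2} \<subseteq> U"
        "y1 \<noteq> y2" "y1 \<notin> {x1, x2}" "y2 \<notin> {x1, x2}" "{x1, x2, y1} \<in> T" "{x1, x2, y2} \<in> T"
      by (auto simp: witnessed_two_cycle_def)
    have k2: "k = 2" using xy k by simp
    \<comment> \<open>The definition of a two-cycle does not state that \<open>x1\<close> and
      \<open>x2\<close> differ; this comes from the size of a hyperedge.\<close>
    have "card {x1, x2, y1} = 3" using H xy by (simp add: hypergraph_def)
    then have "x1 \<noteq> x2" using card_insert_le_m1 by (auto simp: card_insert_if split: if_splits)
    have two: "{..<k} = {0, 1}" using k2 by auto
    \<comment> \<open>Both edges contain the same pair of cycle vertices, so they are told apart by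
      their witnesses.\<close>
    have "inj_on ?E {..<k}" unfolding two using xy k2 by (auto simp: inj_on_def)
    moreover have "?E i \<in> T" if "i < k" for i
    proof -
      have "i = 0 \<or> i = 1" using that k2 by auto
      then show ?thesis using xy k2 by (auto simp: insert_commute)
    qed
    ultimately show ?thesis
      using xy k2 \<open>x1 \<noteq> x2\<close> \<open>k \<le> l\<close>
      by (intro cyclic_edges_minimal_dense[OF H modest, where E = ?E]) auto
  next
    case 2
    then have "3 \<le> k" "length ys = k" "distinct xs" "set xs \<subseteq> U" "set ys \<subseteq> U"
      using k by (auto simp: witnessed_long_cycle_def long_cycle_def weak_cycle_def)
    moreover have "?E i \<in> T" if "i < k" for i
      using 2 that k by (auto simp: witnessed_long_cycle_def witnesses_def)
    moreover have "inj_on ?E {..<k}" using long_cycle_edges_inj[OF H 2] k by simp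
    ultimately show ?thesis using k \<open>k \<le> l\<close>
      by (intro cyclic_edges_minimal_dense[OF H modest, where E = ?E]) auto
  qed
qed

section \<open>Minimal dense sets are vertex sets of witnessed cycles\<close>

text \<open>Deleting \<open>S\<close> leaves a nonempty proper subset, which is not dense by
  minimality; comparing its weight with the equality \<open>w\<close> bounds from below the number
  of edges lost. Singletons give positive degrees, and pairs show that no edge has two vertices of
  degree one.\<close>

lemma minimal_dense_edges_meeting:
  assumes H: "hypergraph U T" and X: "minimal_dense_set U T X"
    and S: "S \<subset> X" "S \<noteq> {}" and w: "card X = 2 * weight T X"
  shows "card S < 2 * card {e \<in> T. e \<subseteq> X \<and> e \<inter> S \<noteq> {}}"
proof -
  have XU: "X \<subseteq> U" using X by (simp add: minimal_dense_set_def dense_set_def)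
  then have finX: "finite X" using H finite_subset by (auto simp: hypergraph_def)
  have finT: "finite T" using hypergraph_finite_edges[OF H] .
  have "X - S \<noteq> {}" "X - S \<subset> X" using S by blast+
  then have "\<not> dense_set U T (X - S)" using X by (simp add: minimal_dense_set_def)
  then have "2 * weight T (X - S) < card (X - S)" using S XU by (auto simp: dense_set_def)
  moreover have "card (X - S) = card X - card S"
    using S finX by (intro card_Diff_subset) (auto intro: finite_subset)
  moreover have "weight T X = weight T (X - S) + card {e \<in> T. e \<subseteq> X \<and> e \<inter> S \<noteq> {}}"
    unfolding weight_def using finT
    by (subst card_Un_disjoint[symmetric]) (auto intro!: arg_cong[of _ _ card])
  ultimately show ?thesis using w by linarith
qed

text \<open>Vertices outside \<open>D\<close> have degree one, and no edge contains two of them, so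
  \<open>card (X - D) \<le> card F\<close>. The degree sum \<open>3 * card F\<close> is at least
  \<open>card (X - D) + 2 * card D\<close>; as \<open>card X = 2 * card F\<close>, this yields the
  reverse inequality. Equality makes the map from degree-one vertices to their edges a
  bijection.\<close>

lemma minimal_dense_one_leaf:
  assumes H: "hypergraph U T" and X: "minimal_dense_set U T X"
    and w: "card X = 2 * weight T X"
    and F: "F = {e \<in> T. e \<subseteq> X}"
    and D: "D = {v \<in> X. 2 \<le> card {e \<in> F. v \<in> e}}"
  shows "2 * card D = card X" and "\<And>e. e \<in> F \<Longrightarrow> \<exists>p. e - D = {p}"
proof -
  have XU: "X \<subseteq> U" and Xne: "X \<noteq> {}"
    using X by (auto simp: minimal_dense_set_def dense_set_def)
  then have finX: "finite X" using H finite_subset by (auto simp: hypergraph_def)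
  have finF: "finite F" using hypergraph_finite_edges[OF H] by (simp add: F)
  have wF: "weight T X = card F" by (simp add: weight_def F)
  have e3: "card e = 3" "e \<subseteq> X" if "e \<in> F" for e using that H by (auto simp: F hypergraph_def)
  define d where "d v = card {e \<in> F. v \<in> e}" for v
  have "F \<noteq> {}" using w wF finX Xne by auto
  then have "3 \<le> card X" using e3 card_mono[OF finX] by (metis ex_in_conv)
  \<comment> \<open>Parity raises the bound from 3 to 4, so singletons and pairs in \<open>X\<close>
    are proper subsets.\<close>
  then have X4: "4 \<le> card X" using w by presburger
  have meet: "card S < 2 * card {e \<in> F. e \<inter> S \<noteq> {}}" if "S \<subset> X" "S \<noteq> {}" for S
    using minimal_dense_edges_meeting[OF H X that w] by (simp add: F conj_assoc)
  have d_pos: "1 \<le> d v" if "v \<in> X" for v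
  proof -
    have "{v} \<subset> X" using that X4 by (auto simp: psubset_eq)
    then show ?thesis using meet[of "{v}"] by (simp add: d_def)
  qed
  have leaf: "d v = 1" if "v \<in> X" "v \<notin> D" for v
    using that d_pos[of v] by (auto simp: D d_def)
  have leaf_edge: "{f \<in> F. v \<in> f} = {e}" if "v \<in> e - D" "e \<in> F" for v e
  proof -
    have "card {f \<in> F. v \<in> f} = 1" using leaf[of v] that e3 by (auto simp: d_def)
    then obtain g where g: "{f \<in> F. v \<in> f} = {g}" by (rule card_1_singletonE)
    have "e \<in> {f \<in> F. v \<in> f}" using that by simp
    then have "e = g" unfolding g by simp
    then show ?thesis using g by simp
  qed
  have le1: "p = q" if "e \<in> F" "p \<in> e - D" "q \<in> e - D" for e p q
  proof (rule ccontr)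
    assume "p \<noteq> q"
    then have c2: "card {p, q} = 2" by simp
    have "{p, q} \<subset> X" using that e3 c2 X4 by (auto simp: psubset_eq)
    \<comment> \<open>Both vertices have \<open>e\<close> as their only edge, so the bound for the
      pair would read \<open>2 < 2\<close>.\<close>
    moreover have "{f \<in> F. f \<inter> {p, q} \<noteq> {}} = {e}"
      using leaf_edge[of p e] leaf_edge[of q e] that by blast
    ultimately show False using meet[of "{p, q}"] c2 by simp
  qed
  have "\<exists>e. e \<in> F \<and> v \<in> e" if "v \<in> X - D" for v
  proof -
    have "card {e \<in> F. v \<in> e} \<noteq> 0" using d_pos[of v] that by (simp add: d_def)
    then have "{e \<in> F. v \<in> e} \<noteq> {}" by (metis card.empty)
    then show ?thesis by blast
  qed
  then obtain h where h: "\<And>v. v \<in> X - D \<Longrightarrow> h v \<in> F \<and> v \<in> h v" by metis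
  have inj: "inj_on h (X - D)"
  proof (rule inj_onI)
    fix v u assume vu: "v \<in> X - D" "u \<in> X - D" "h v = h u"
    then have "v \<in> h v - D" "u \<in> h v - D" using h[of v] h[of u] by auto
    then show "v = u" using le1 h vu(1) by blast
  qed
  have hF: "h ` (X - D) \<subseteq> F" using h by blast
  have le: "card (X - D) \<le> card F"
    using card_inj_on_le[OF inj hF finF] .
  have DX: "D \<subseteq> X" by (auto simp: D)
  have cXD: "card (X - D) + card D = card X"
    using card_Diff_subset[OF finite_subset[OF DX finX] DX] card_mono[OF finX DX] by simp
  \<comment> \<open>Double counting of incidences between vertices and edges.\<close>
  have "(\<Sum>v\<in>X. d v) = (\<Sum>e\<in>F. card {v \<in> X. v \<in> e})"
    unfolding d_def by (rule sum_multicount_gen[symmetric]) (use finX finF in auto)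
  also have "\<dots> = (\<Sum>e\<in>F. 3)"
  proof (rule sum.cong)
    fix e assume "e \<in> F"
    then have "{v \<in> X. v \<in> e} = e" using e3 by blast
    then show "card {v \<in> X. v \<in> e} = 3" using e3 \<open>e \<in> F\<close> by simp
  qed simp
  finally have total: "(\<Sum>v\<in>X. d v) = 3 * card F" by simp
  have "(\<Sum>v\<in>X. d v) = (\<Sum>v\<in>X - D. d v) + (\<Sum>v\<in>D. d v)"
    using sum.subset_diff[OF DX finX] .
  moreover have "(\<Sum>v\<in>X - D. d v) = card (X - D)" using leaf by simp
  moreover have "(\<Sum>v\<in>D. 2) \<le> (\<Sum>v\<in>D. d v)"
    by (rule sum_mono) (simp add: D d_def)
  then have "2 * card D \<le> (\<Sum>v\<in>D. d v)" by simp
  ultimately have eq: "card (X - D) = card F" "2 * card D = card X"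
    using total le cXD w wF by linarith+
  then show "2 * card D = card X" by simp
  have "h ` (X - D) = F"
    using card_subset_eq[OF finF hF] eq inj by (simp add: card_image)
  then show "\<exists>p. e - D = {p}" if e: "e \<in> F" for e
  proof -
    obtain v where v: "v \<in> X - D" "e = h v" using e \<open>h ` (X - D) = F\<close> by blast
    then have "v \<in> e - D" using h by blast
    then have "e - D = {v}" using le1[OF e] by blast
    then show ?thesis by blast
  qed
qed

text \<open>It suffices to find inside \<open>X\<close> a witnessed cycle of some length at most
  \<open>k\<close>. Since \<open>k \<le> l\<close>, the other direction makes its vertex set dense;
  minimality of \<open>X\<close> forces equality, and comparing cardinalities gives length
  \<open>k\<close>.\<close>

lemma minimal_dense_is_witnessed_cycle:
  assumes H: "hypergraph U T" and modest: "modest l U T" and "k \<le> l"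
    and X: "minimal_dense_set U T X" and cX: "card X = 2 * k"
  shows "\<exists>xs ys. witnessed_cycle U T k xs ys \<and> X = set xs \<union> set ys"
proof -
  have XU: "X \<subseteq> U" and Xne: "X \<noteq> {}" and Xd: "card X \<le> 2 * weight T X"
    using X by (auto simp: minimal_dense_set_def dense_set_def)
  then have finX: "finite X" using H finite_subset by (auto simp: hypergraph_def)
  have w: "card X = 2 * weight T X"
    using modest_weight_le[OF modest XU Xne] Xd cX \<open>k \<le> l\<close> by simp
  define F where "F = {e \<in> T. e \<subseteq> X}"
  define D where "D = {v \<in> X. 2 \<le> card {e \<in> F. v \<in> e}}"
  note leaf = minimal_dense_one_leaf[OF H X w F_def D_def]
  have cD: "card D = k" using leaf(1) cX by simp
  have DX: "D \<subseteq> X" and finD: "finite D" using finX by (auto simp: D_def)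
  have "k \<noteq> 0" using cX finX Xne by auto
  then have Dne: "D \<noteq> {}" using cD by auto
  have e3: "card e = 3" "e \<subseteq> X" "e \<in> T" if "e \<in> F" for e
    using that H by (auto simp: F_def hypergraph_def)
  \<comment> \<open>Each hyperedge at \<open>x\<close> thus acts as a graph edge from
    \<open>x\<close> to \<open>a\<close> inside \<open>D\<close>, labelled by its degree-one vertex
    \<open>p\<close>.\<close>
  have two: "\<exists>a\<in>D. \<exists>p. a \<noteq> x \<and> p \<in> X - D \<and> e = {x, a, p}" if e: "e \<in> F" and "x \<in> e" "x \<in> D" for e x
  proof -
    obtain p where p: "e - D = {p}" using leaf(2)[OF e] by blast
    have fin: "finite e" using e3(1)[OF e] by (metis card.infinite zero_neq_numeral)
    have "p \<noteq> x" "p \<in> e" using p that by auto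
    then have "card (e - {x, p}) = 1"
      using e3(1)[OF e] that fin by (simp add: card_Diff_subset)
    then obtain a where a: "e - {x, p} = {a}" by (auto simp: card_1_singleton_iff)
    then have "a \<in> D" "a \<noteq> x" using p by blast+
    moreover have "e = {x, a, p}" using a \<open>p \<in> e\<close> that by blast
    ultimately show ?thesis using p e3(2)[OF e] by blast
  qed
  have "\<exists>xs ys. witnessed_cycle U T (length xs) xs ys \<and> length xs \<le> k \<and> set xs \<union> set ys \<subseteq> X"
  \<comment> \<open>Two parallel graph edges give a cycle of length 2. Otherwise the graph on
    \<open>D\<close> is simple, and two hyperedges at a vertex lead to distinct neighbours.\<close>
  proof (cases "\<exists>e\<in>F. \<exists>f\<in>F. \<exists>x\<in>D. \<exists>a\<in>D. e \<noteq> f \<and> x \<noteq> a \<and> {x, a} \<subseteq> e \<inter> f")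
    case True
    then obtain e f x a where ef: "e \<in> F" "f \<in> F" "x \<in> D" "a \<in> D" "e \<noteq> f" "x \<noteq> a"
        "{x, a} \<subseteq> e \<inter> f" by blast
    obtain p where p: "p \<in> X - D" "e = {x, a, p}" using two[of e x] ef by auto
    obtain q where q: "q \<in> X - D" "f = {x, a, q}" using two[of f x] ef by auto
    have "witnessed_two_cycle U T [x, a] [p, q]"
      unfolding witnessed_two_cycle_def using p q ef DX XU e3(3) by auto
    moreover have "2 \<le> k"
      using card_mono[OF finD, of "{x, a}"] ef cD by simp
    moreover have "set [x, a] \<union> set [p, q] \<subseteq> X" using p q ef DX by auto
    ultimately have "witnessed_cycle U T (length [x, a]) [x, a] [p, q] \<and> length [x, a] \<le> k
        \<and> set [x, a] \<union> set [p, q] \<subseteq> X"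
      by (simp add: witnessed_cycle_def)
    then show ?thesis by blast
  next
    case simple: False
    define R where "R x a \<longleftrightarrow> x \<in> D \<and> a \<in> D \<and> x \<noteq> a \<and> (\<exists>p\<in>X - D. {x, a, p} \<in> F)" for x a
    have "\<exists>a\<in>D. \<exists>b\<in>D. a \<noteq> b \<and> R x a \<and> R x b" if x: "x \<in> D" for x
    proof -
      have "2 \<le> card {e \<in> F. x \<in> e}" using x by (simp add: D_def)
      then obtain e f where ef: "e \<in> F" "f \<in> F" "x \<in> e" "x \<in> f" "e \<noteq> f"
        unfolding numeral_2_eq_2 card_le_Suc_iff by blast
      obtain a p where a: "a \<in> D" "a \<noteq> x" "p \<in> X - D" "e = {x, a, p}" using two ef x by metis
      obtain b q where b: "b \<in> D" "b \<noteq> x" "q \<in> X - D" "f = {x, b, q}" using two ef x by metis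
      have "a \<noteq> b"
      proof
        assume "a = b"
        then have "{x, a} \<subseteq> e \<inter> f" using a(4) b(4) by simp
        then show False using simple ef(1,2,5) x a(1,2) by metis
      qed
      moreover have "R x a" "R x b" using a b ef x by (auto simp: R_def)
      ultimately show ?thesis using a b by blast
    qed
    moreover have "R y x" if "R x y" for x y using that by (auto simp: R_def insert_commute)
    moreover have "\<not> R x x" for x by (simp add: R_def)
    ultimately obtain xs where xs: "3 \<le> length xs" "distinct xs" "set xs \<subseteq> D"
        "\<And>i. i < length xs \<Longrightarrow> R (xs ! i) (xs ! (Suc i mod length xs))"
      using min_degree_two_cycle[OF finD Dne, of R] by metis
    have "\<exists>y. y \<in> X \<and> {xs ! i, xs ! (Suc i mod length xs), y} \<in> T" if "i < length xs" for i
      using xs(4)[OF that] e3(3) by (auto simp: R_def)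
    then obtain g where g: "\<And>i. i < length xs \<Longrightarrow>
        g i \<in> X \<and> {xs ! i, xs ! (Suc i mod length xs), g i} \<in> T" by metis
    define ys where "ys = map g [0..<length xs]"
    have yX: "set ys \<subseteq> X" using g by (auto simp: ys_def)
    \<comment> \<open>Each hyperedge inside \<open>X\<close> has a vertex outside \<open>D\<close>,
      so no three cycle vertices form a hyperedge. This settles the exclusion conditions for weak
      cycles and for cycles at once.\<close>
    have noD: "e \<notin> T" if "e \<subseteq> D" for e
      using leaf(2)[of e] that DX by (auto simp: F_def)
    have xD: "xs ! i \<in> D" if "i < length xs" for i using that xs by auto
    have "weak_cycle U T xs" unfolding weak_cycle_def
    proof (intro conjI)
      show "set xs \<subseteq> U" using xs DX XU by blast
      show "\<forall>i<length xs. adjacent T (xs ! i) (xs ! ((i + 1) mod length xs))"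
        using g by (auto simp: adjacent_def witnesses_def)
      have "{xs ! 0, xs ! 1, xs ! 2} \<notin> T" using xs(1) by (intro noD) (auto intro!: xD)
      then show "3 < length xs \<or> {xs ! 0, xs ! 1, xs ! 2} \<notin> T" by blast
    qed (use xs in auto)
    moreover have "{xs ! i, xs ! ((i + 1) mod length xs), xs ! ((i + 2) mod length xs)} \<notin> T"
      if "i < length xs" for i
    proof -
      have "0 < length xs" using xs(1) by linarith
      then show ?thesis using that xD by (intro noD) auto
    qed
    ultimately have "witnessed_long_cycle U T xs ys"
      using g yX XU by (auto simp: witnessed_long_cycle_def long_cycle_def witnesses_def ys_def)
    moreover have "length xs \<le> k" using finite_path_bound[OF finD xs(2,3)] cD by simp
    moreover have "set xs \<union> set ys \<subseteq> X" using xs(3) yX DX by blast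
    ultimately have "witnessed_cycle U T (length xs) xs ys \<and> length xs \<le> k
        \<and> set xs \<union> set ys \<subseteq> X"
      by (simp add: witnessed_cycle_def)
    then show ?thesis by blast
  qed
  then obtain xs ys where C: "witnessed_cycle U T (length xs) xs ys" "length xs \<le> k"
    "set xs \<union> set ys \<subseteq> X" by blast
  then have V: "minimal_dense_set U T (set xs \<union> set ys)"
    "card (set xs \<union> set ys) = 2 * length xs"
    using witnessed_cycle_minimal_dense[OF H modest _ C(1)] \<open>k \<le> l\<close> by auto
  then have "dense_set U T (set xs \<union> set ys)" "set xs \<union> set ys \<noteq> {}"
    by (simp_all add: minimal_dense_set_def dense_set_def)
  then have XV: "X = set xs \<union> set ys"
    using X C(3) unfolding minimal_dense_set_def by (metis psubsetI)
  then have "length xs = k" using V(2) cX by simp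
  then show ?thesis using XV C(1) by blast
qed

theorem theorem2p2p1:
  fixes U :: "'a set" and T :: "'a set set" and l :: nat
  assumes "hypergraph U T" and "l \<ge> 2" and "modest l U T"
  shows "(\<forall>k X. 2 * k \<le> 2 * l \<and> minimal_dense_set U T X \<and> card X = 2 * k \<longrightarrow>
            (\<exists>xs ys. witnessed_cycle U T k xs ys \<and> X = set xs \<union> set ys)) \<and>
         (\<forall>k xs ys. k \<le> l \<and> witnessed_cycle U T k xs ys \<longrightarrow>
            minimal_dense_set U T (set xs \<union> set ys) \<and> card (set xs \<union> set ys) = 2 * k)"
  using minimal_dense_is_witnessed_cycle[OF assms(1,3)]
    witnessed_cycle_minimal_dense[OF assms(1,3)] by (intro conjI allI impI) auto

end
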